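(* For $n\geq 2$, $$SB_n=\frac{24}{5}\cdot\frac{(5n^3-5n+6)\,a_{n+1}-(5n^2+15n+18)\,a_n}{(n-1)\,n^2\,(n+2)^2\,(n+3)^2\,(n+4)},$$ where $a_n=\sum_{j=0}^n\binom{n}{j}^2\binom{n+j}{j}$.
   Context: $SB_n$ is the number of semi-Baxter permutations of size $n$, i.e. permutations $\pi$ of $\{1,\dots,n\}$ with no indices $i<j$ and $k>j+1$ such that $\pi_{j+1}<\pi_i<\pi_k<\pi_j$. *)

theory Defs
  imports Complex_Main "HOL-Combinatorics.Permutations"
begin

text \<open>
  Permutations of \<open>{1..n}\<close> in one-line notation \<open>\<pi> 1, \<dots>, \<pi> n\<close>.
  The excluded configuration is an occurrence of the vincular pattern 2-41-3, in which the
  entries playing the roles of 4 and 1 are adjacent, at positions \<open>j\<close> and \<open>j + 1\<close>.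
\<close>

definition semi_baxter :: "nat \<Rightarrow> (nat \<Rightarrow> nat) \<Rightarrow> bool" where
  "semi_baxter n \<pi> \<longleftrightarrow> \<pi> permutes {1..n} \<and>
     \<not> (\<exists>i\<in>{1..n}. \<exists>j\<in>{1..n}. \<exists>k\<in>{1..n}. i < j \<and> k > j + 1 \<and>
          \<pi> (j + 1) < \<pi> i \<and> \<pi> i < \<pi> k \<and> \<pi> k < \<pi> j)"

definition SB :: "nat \<Rightarrow> nat" where
  "SB n = card {\<pi>. semi_baxter n \<pi>}"

definition a_seq :: "nat \<Rightarrow> nat" where
  "a_seq n = (\<Sum>j=0..n. (n choose j)\<^sup>2 * ((n + j) choose j))"

end

theory Submission
  imports Defs
begin

text \<open>
  A semi-Baxter permutation of size \<open>n + 1\<close> arises from one of size \<open>n\<close> by appending a last entry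
  \<open>a\<close> and moving the old values \<open>\<ge> a\<close> up by one. Call \<open>a\<close> active if this creates no forbidden
  pattern. The further growth depends only on the number \<open>h\<close> of active values that are at most the
  last entry and the number \<open>k\<close> of those above it: the permutations form a tree in which the root
  has label \<open>(1, 1)\<close> and a node \<open>(h, k)\<close> has the children \<open>(i, k + 1)\<close> for \<open>1 \<le> i \<le> h\<close> and
  \<open>(h + k + 1 - j, j)\<close> for \<open>1 \<le> j \<le> k\<close> (lemma \<open>sum_children\<close>).

  The descendants of a node are counted by the kernel method with the group of the kernel made
  explicit. Put \<open>x1 = u\<close>, \<open>x2 = v\<close>, \<open>x3 = (1 + v) / u\<close>, \<open>x4 = (1 + u + v) / (u v)\<close>,
  \<open>x0 = (1 + u) / v\<close>. With indices modulo 5 these satisfy the pentagon recurrence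
  \<open>x(i-1) x(i+1) = 1 + x(i)\<close>, and taking the constant term of a Laurent polynomial in \<open>u, v\<close> is
  invariant under the dihedral group permuting the \<open>x(i)\<close>. Their product
  \<open>L = (1 + u) (1 + v) (1 + u + v) / (u v)\<close> is invariant as well, and \<open>a\<^sub>n\<close> is the constant term of
  \<open>L\<^sup>n\<close>. Weight the label \<open>(h, k)\<close> with \<open>y\<^sup>h z\<^sup>k\<close>, where \<open>y = x1 x3 / x2\<close> and \<open>z = x1 x4\<close>. As
  \<open>y - 1 = 1 / x2\<close> and \<open>z - y = x1 / x2\<close>, the weights of the children are two geometric sums; their
  upper ends add up to \<open>L y\<^sup>h z\<^sup>k\<close>, and their lower ends, multiplied by \<open>x0 / (x1 x3)\<close>, are
  invariant under the reflection fixing \<open>x0\<close> and the one fixing \<open>x2\<close>, respectively. Multiplying in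
  addition by the alternating polynomial \<open>A = (\<Sum>i. x(i)\<^sup>2 x(i+1) - x(i) x(i+1)\<^sup>2)\<close> therefore makes
  the constant terms of both lower ends vanish. Hence the constant term of
  \<open>L\<^sup>m A y\<^sup>h z\<^sup>k x0 / (x1 x3)\<close> obeys the recursion of the tree (lemma \<open>descendants_Suc\<close>), and
  \<open>A\<close> is such that for \<open>m = 0\<close> it is \<open>h + k\<close>, the number of children of \<open>(h, k)\<close>. So it counts the
  descendants \<open>m + 1\<close> levels below \<open>(h, k)\<close>, and at \<open>(1, 1)\<close> it yields \<open>SB (m + 2)\<close> as an alternating
  sum of ten constant terms of monomials in the \<open>x(i)\<close> (theorem \<open>SB_eq_CT_alt\<close>).

  Each of these constant terms, and each of \<open>a\<^sub>n\<close> and \<open>a\<^sub>n\<^sub>+\<^sub>1\<close>, is a single sum of products of binomial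
  coefficients, and all the summands are polynomial multiples of one hypergeometric term. The
  relation between them is then a telescoping sum with a polynomial certificate.
\<close>

section \<open>The generating tree\<close>

definition shift_up :: "nat \<Rightarrow> nat \<Rightarrow> nat" where
  "shift_up a x = (if x < a then x else Suc x)"

definition append_value :: "nat \<Rightarrow> nat \<Rightarrow> (nat \<Rightarrow> nat) \<Rightarrow> nat \<Rightarrow> nat" where
  "append_value n a \<pi> i = (if i \<in> {1..n} then shift_up a (\<pi> i) else if i = Suc n then a else i)"

text \<open>
  The condition ranges over all occurrences \<open>\<pi> i, \<pi> j, \<pi> (Suc j)\<close> of the first three letters of
  2-41-3 that a new last entry \<open>a\<close> would complete; \<open>a \<le> \<pi> j\<close> is not strict because \<open>\<pi> j\<close> moves up
  when \<open>a\<close> is inserted.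
\<close>

definition active :: "nat \<Rightarrow> (nat \<Rightarrow> nat) \<Rightarrow> nat set" where
  "active n \<pi> = {a \<in> {1..Suc n}. \<not> (\<exists>i j. 1 \<le> i \<and> i < j \<and> Suc j \<le> n \<and>
      \<pi> (Suc j) < \<pi> i \<and> \<pi> i < a \<and> a \<le> \<pi> j)}"

lemma finite_active [simp]: "finite (active n \<pi>)"
  by (simp add: active_def)

lemma semi_baxter_iff:
  "semi_baxter n \<pi> \<longleftrightarrow> \<pi> permutes {1..n} \<and>
     (\<forall>i j k. 1 \<le> i \<longrightarrow> i < j \<longrightarrow> Suc j < k \<longrightarrow> k \<le> n \<longrightarrow>
        \<pi> (Suc j) < \<pi> i \<longrightarrow> \<pi> i < \<pi> k \<longrightarrow> \<not> \<pi> k < \<pi> j)"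
  unfolding semi_baxter_def by (fastforce simp: Ball_def)

lemma shift_up_less_iff [simp]: "shift_up a x < shift_up a y \<longleftrightarrow> x < y"
  by (auto simp: shift_up_def)

lemma shift_up_eq_iff [simp]: "shift_up a x = shift_up a y \<longleftrightarrow> x = y"
  by (auto simp: shift_up_def)

lemma shift_up_neq [simp]: "shift_up a x \<noteq> a" "a \<noteq> shift_up a x"
  by (auto simp: shift_up_def)

lemma shift_up_less [simp]: "shift_up a x < a \<longleftrightarrow> x < a"
  by (auto simp: shift_up_def)

lemma less_shift_up [simp]: "a < shift_up a x \<longleftrightarrow> a \<le> x"
  by (auto simp: shift_up_def)

lemma permutes_atLeastAtMost_bounds:
  assumes "\<pi> permutes {1..n}" "1 \<le> i" "i \<le> n"
  shows "1 \<le> \<pi> i" "\<pi> i \<le> n"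
  using permutes_in_image[OF assms(1), of i] assms(2,3) by auto

lemma append_value_permutes:
  assumes \<pi>: "\<pi> permutes {1..n}" and a: "a \<in> {1..Suc n}"
  shows "append_value n a \<pi> permutes {1..Suc n}"
proof (rule bij_imp_permutes)
  have "inj_on (append_value n a \<pi>) {1..Suc n}"
  proof (rule inj_onI)
    fix i j assume "i \<in> {1..Suc n}" "j \<in> {1..Suc n}" "append_value n a \<pi> i = append_value n a \<pi> j"
    then show "i = j"
      using inj_eq[OF permutes_inj[OF \<pi>]]
      by (auto simp: append_value_def split: if_splits)
  qed
  moreover have "append_value n a \<pi> i \<in> {1..Suc n}" if "i \<in> {1..Suc n}" for i
    using permutes_atLeastAtMost_bounds[OF \<pi>, of i] a that
    by (auto simp: append_value_def shift_up_def)
  then have "append_value n a \<pi> ` {1..Suc n} \<subseteq> {1..Suc n}" by blast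
  ultimately show "bij_betw (append_value n a \<pi>) {1..Suc n} {1..Suc n}"
    by (simp add: bij_betw_def endo_inj_surj)
qed (auto simp: append_value_def)

text \<open>
  Shifting preserves the order of the old entries, so the old patterns stay as they are and only
  patterns ending in the new entry have to be excluded.
\<close>

lemma semi_baxter_append_value:
  assumes \<pi>: "\<pi> permutes {1..n}" and a: "a \<in> {1..Suc n}"
  shows "semi_baxter (Suc n) (append_value n a \<pi>) \<longleftrightarrow> semi_baxter n \<pi> \<and> a \<in> active n \<pi>"
proof -
  let ?\<sigma> = "append_value n a \<pi>"
  let ?bad = "\<lambda>\<sigma> i j k. 1 \<le> i \<and> i < j \<and> Suc j < k \<and> \<sigma> (Suc j) < \<sigma> i \<and> \<sigma> i < \<sigma> k \<and> \<sigma> k < (\<sigma> j :: nat)"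
  have old: "?bad ?\<sigma> i j k \<longleftrightarrow> ?bad \<pi> i j k" if "k \<le> n" for i j k
    using that by (auto simp: append_value_def)
  have new: "?bad ?\<sigma> i j (Suc n) \<longleftrightarrow> 1 \<le> i \<and> i < j \<and> Suc j \<le> n \<and>
      \<pi> (Suc j) < \<pi> i \<and> \<pi> i < a \<and> a \<le> \<pi> j" for i j
    by (auto simp: append_value_def)
  have "semi_baxter (Suc n) ?\<sigma> \<longleftrightarrow> (\<forall>i j k. k \<le> Suc n \<longrightarrow> \<not> ?bad ?\<sigma> i j k)"
    unfolding semi_baxter_iff using append_value_permutes[OF \<pi> a] by blast
  also have "\<dots> \<longleftrightarrow> (\<forall>i j k. k \<le> n \<longrightarrow> \<not> ?bad ?\<sigma> i j k) \<and> (\<forall>i j. \<not> ?bad ?\<sigma> i j (Suc n))"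
    unfolding le_Suc_eq by blast
  also have "\<dots> \<longleftrightarrow> (\<forall>i j k. k \<le> n \<longrightarrow> \<not> ?bad \<pi> i j k) \<and> a \<in> active n \<pi>"
    unfolding new active_def using old a by blast
  also have "\<dots> \<longleftrightarrow> semi_baxter n \<pi> \<and> a \<in> active n \<pi>"
    unfolding semi_baxter_iff using \<pi> by blast
  finally show ?thesis .
qed

lemma append_value_surj:
  assumes \<sigma>: "\<sigma> permutes {1..Suc n}"
  obtains \<pi> a where "\<pi> permutes {1..n}" "a \<in> {1..Suc n}" "\<sigma> = append_value n a \<pi>"
proof -
  define a where "a = \<sigma> (Suc n)"
  define \<pi> where "\<pi> i = (if i \<in> {1..n} then if \<sigma> i < a then \<sigma> i else \<sigma> i - 1 else i)" for i
  have a: "a \<in> {1..Suc n}"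
    using permutes_atLeastAtMost_bounds[OF \<sigma>, of "Suc n"] by (simp add: a_def)
  have ne: "\<sigma> i \<noteq> a" if "i \<in> {1..n}" for i
    using inj_eq[OF permutes_inj[OF \<sigma>]] that by (auto simp: a_def)
  have bounds: "1 \<le> \<sigma> i \<and> \<sigma> i \<le> Suc n" if "i \<in> {1..n}" for i
    using permutes_atLeastAtMost_bounds[OF \<sigma>, of i] that by simp
  have up: "shift_up a (\<pi> i) = \<sigma> i" if "i \<in> {1..n}" for i
    using that ne[OF that] bounds[OF that] by (auto simp: \<pi>_def shift_up_def)
  have "\<pi> permutes {1..n}"
  proof (rule bij_imp_permutes)
    have "inj_on \<pi> {1..n}"
      by (metis inj_onI up permutes_inj[OF \<sigma>] injD)
    moreover have "\<pi> ` {1..n} \<subseteq> {1..n}"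
    proof safe
      fix i assume "i \<in> {1..n}"
      then show "\<pi> i \<in> {1..n}"
        using ne[of i] bounds[of i] a by (auto simp: \<pi>_def)
    qed
    ultimately show "bij_betw \<pi> {1..n} {1..n}"
      by (simp add: bij_betw_def endo_inj_surj)
  qed (auto simp: \<pi>_def)
  moreover have "\<sigma> = append_value n a \<pi>"
  proof
    fix i
    consider "i \<in> {1..n}" | "i = Suc n" | "i \<notin> {1..Suc n}" by force
    then show "\<sigma> i = append_value n a \<pi> i"
    proof cases
      case 3
      then show ?thesis using permutes_not_in[OF \<sigma>] by (auto simp: append_value_def)
    qed (simp_all add: append_value_def up flip: a_def)
  qed
  ultimately show thesis using that a by blast
qed

lemma append_value_inject:
  assumes "\<pi> permutes {1..n}" "\<pi>' permutes {1..n}" "append_value n a \<pi> = append_value n a' \<pi>'"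
  shows "a = a'" "\<pi> = \<pi>'"
proof -
  show a: "a = a'" using fun_cong[OF assms(3), of "Suc n"] by (simp add: append_value_def)
  show "\<pi> = \<pi>'"
  proof
    fix i
    show "\<pi> i = \<pi>' i"
    proof (cases "i \<in> {1..n}")
      case True
      then show ?thesis using fun_cong[OF assms(3), of i] a
        by (simp add: append_value_def)
    next
      case False
      then show ?thesis using assms(1,2) by (simp add: permutes_def)
    qed
  qed
qed

lemma sum_semi_baxter_Suc:
  "(\<Sum>\<sigma> | semi_baxter (Suc n) \<sigma>. F \<sigma>)
     = (\<Sum>\<pi> | semi_baxter n \<pi>. \<Sum>a\<in>active n \<pi>. F (append_value n a \<pi>))"
proof -
  have fin: "finite {\<pi>. semi_baxter n \<pi>}"
    by (rule finite_subset[OF _ finite_permutations[of "{1..n}"]]) (auto simp: semi_baxter_def)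
  let ?app = "\<lambda>(\<pi>, a). append_value n a \<pi>"
  have "bij_betw ?app (Sigma {\<pi>. semi_baxter n \<pi>} (active n)) {\<sigma>. semi_baxter (Suc n) \<sigma>}"
    unfolding bij_betw_def
  proof
    show "inj_on ?app (Sigma {\<pi>. semi_baxter n \<pi>} (active n))"
    proof (rule inj_onI)
      fix p q
      assume p: "p \<in> Sigma {\<pi>. semi_baxter n \<pi>} (active n)"
        and q: "q \<in> Sigma {\<pi>. semi_baxter n \<pi>} (active n)" and eq: "?app p = ?app q"
      from p q have "fst p permutes {1..n}" "fst q permutes {1..n}"
        by (auto simp: semi_baxter_iff)
      from append_value_inject[OF this, of "snd p" "snd q"] eq show "p = q"
        by (simp add: case_prod_unfold prod_eq_iff)
    qed
    show "?app ` Sigma {\<pi>. semi_baxter n \<pi>} (active n) = {\<sigma>. semi_baxter (Suc n) \<sigma>}"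
    proof
      show "?app ` Sigma {\<pi>. semi_baxter n \<pi>} (active n) \<subseteq> {\<sigma>. semi_baxter (Suc n) \<sigma>}"
        using semi_baxter_append_value by (auto simp: semi_baxter_iff[of n] active_def)
    next
      show "{\<sigma>. semi_baxter (Suc n) \<sigma>} \<subseteq> ?app ` Sigma {\<pi>. semi_baxter n \<pi>} (active n)"
      proof
        fix \<sigma> assume "\<sigma> \<in> {\<sigma>. semi_baxter (Suc n) \<sigma>}"
        then have \<sigma>: "semi_baxter (Suc n) \<sigma>" by simp
        then obtain \<pi> a where "\<pi> permutes {1..n}" "a \<in> {1..Suc n}" "\<sigma> = append_value n a \<pi>"
          using append_value_surj[of \<sigma> n] by (auto simp: semi_baxter_def)
        with \<sigma> show "\<sigma> \<in> ?app ` Sigma {\<pi>. semi_baxter n \<pi>} (active n)"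
          by (auto simp: semi_baxter_append_value image_iff)
      qed
    qed
  qed
  from sum.reindex_bij_betw[OF this, of F] show ?thesis
    using fin by (simp add: sum.Sigma case_prod_unfold)
qed

text \<open>
  Besides the old restrictions, the new last descent restricts later entries only if \<open>a \<le> \<pi> n\<close>. In
  that case the old value \<open>a\<close>, now \<open>a + 1\<close>, plays the role of the 2 whenever \<open>a \<noteq> \<pi> n\<close>, and exactly
  the values from \<open>a + 2\<close> to \<open>\<pi> n + 1\<close> become inactive. The active value \<open>a\<close> itself splits into
  \<open>a\<close> and \<open>a + 1\<close>.
\<close>

lemma active_append_value:
  assumes \<pi>: "\<pi> permutes {1..n}" and n: "1 \<le> n" and a: "a \<in> active n \<pi>"
  shows "active (Suc n) (append_value n a \<pi>) =
    {s \<in> active n \<pi>. s \<le> a} \<union> Suc ` {s \<in> active n \<pi>. a \<le> s \<and> (s = a \<or> \<pi> n < a \<or> \<pi> n < s)}"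
proof -
  let ?\<sigma> = "append_value n a \<pi>"
  let ?A = "active n \<pi>"
  let ?kill = "\<lambda>\<pi> s i j. 1 \<le> i \<and> i < j \<and> \<pi> (Suc j) < \<pi> i \<and> \<pi> i < s \<and> s \<le> (\<pi> j :: nat)"
  have a_le: "1 \<le> a" "a \<le> Suc n" using a by (auto simp: active_def)
  have low: "?kill ?\<sigma> s i j \<longleftrightarrow> ?kill \<pi> s i j" if "Suc j \<le> n" "s \<le> a" for s i j
    using that by (auto simp: append_value_def shift_up_def)
  have high: "?kill ?\<sigma> (Suc s) i j \<longleftrightarrow> ?kill \<pi> s i j" if "Suc j \<le> n" "a \<le> s" for s i j
    using that by (auto simp: append_value_def shift_up_def)
  have last: "(\<exists>i. ?kill ?\<sigma> s i n) \<longleftrightarrow> Suc a < s \<and> s \<le> Suc (\<pi> n)" (is "?l \<longleftrightarrow> ?r") for s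
  proof
    assume ?l
    then show ?r by (auto simp: append_value_def shift_up_def split: if_splits)
  next
    assume r: ?r
    \<comment> \<open>As \<open>a < \<pi> n\<close>, the entry with old value \<open>a\<close> lies to the left of position \<open>n\<close>.\<close>
    have "a \<in> \<pi> ` {1..n}"
      using permutes_image[OF \<pi>] a_le r permutes_atLeastAtMost_bounds[OF \<pi> n] by auto
    then obtain i where "i \<in> {1..n}" "\<pi> i = a" by auto
    moreover from this r have "i \<noteq> n" by auto
    ultimately have "?kill ?\<sigma> s i n" using r by (auto simp: append_value_def shift_up_def)
    then show ?l by blast
  qed
  have active_iff: "s \<in> active (Suc n) ?\<sigma> \<longleftrightarrow> s \<in> {1..Suc (Suc n)} \<and>
     (\<forall>i j. Suc j \<le> n \<longrightarrow> \<not> ?kill ?\<sigma> s i j) \<and> \<not> (\<exists>i. ?kill ?\<sigma> s i n)" for s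
  proof -
    have "Suc j \<le> Suc n \<longleftrightarrow> Suc j \<le> n \<or> j = n" for j by auto
    then show ?thesis unfolding active_def by blast
  qed
  have active_low: "s \<in> active (Suc n) ?\<sigma> \<longleftrightarrow> s \<in> ?A" if "s \<le> a" for s
    unfolding active_iff last using that a_le low[OF _ that] by (auto simp: active_def)
  have active_high: "Suc s \<in> active (Suc n) ?\<sigma> \<longleftrightarrow> s \<in> ?A \<and> \<not> (a < s \<and> s \<le> \<pi> n)" if "a \<le> s" for s
    unfolding active_iff last using that a_le high[OF _ that] by (auto simp: active_def)
  show ?thesis
  proof (rule set_eqI)
    fix s
    show "s \<in> active (Suc n) ?\<sigma> \<longleftrightarrow> s \<in> {s \<in> ?A. s \<le> a} \<union>
        Suc ` {s \<in> ?A. a \<le> s \<and> (s = a \<or> \<pi> n < a \<or> \<pi> n < s)}"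
    proof (cases "s \<le> a")
      case True
      then show ?thesis using active_low[OF True] by auto
    next
      case False
      then obtain r where r: "s = Suc r" "a \<le> r" by (cases s) auto
      then show ?thesis using active_high[of r] by (auto simp: image_iff)
    qed
  qed
qed

definition lower_sites :: "nat \<Rightarrow> (nat \<Rightarrow> nat) \<Rightarrow> nat" where
  "lower_sites n \<pi> = card {s \<in> active n \<pi>. s \<le> \<pi> n}"

definition upper_sites :: "nat \<Rightarrow> (nat \<Rightarrow> nat) \<Rightarrow> nat" where
  "upper_sites n \<pi> = card {s \<in> active n \<pi>. \<pi> n < s}"

lemma sites_append_value:
  assumes \<pi>: "\<pi> permutes {1..n}" and n: "1 \<le> n" and a: "a \<in> active n \<pi>"
  shows "lower_sites (Suc n) (append_value n a \<pi>) = card {s \<in> active n \<pi>. s \<le> a}"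
    and "upper_sites (Suc n) (append_value n a \<pi>) =
       (if a \<le> \<pi> n then Suc (upper_sites n \<pi>) else card {s \<in> active n \<pi>. a \<le> s})"
proof -
  have end_eq: "append_value n a \<pi> (Suc n) = a" by (simp add: append_value_def)
  show "lower_sites (Suc n) (append_value n a \<pi>) = card {s \<in> active n \<pi>. s \<le> a}"
    unfolding lower_sites_def end_eq active_append_value[OF assms]
    by (rule arg_cong[where f = card]) auto
  have "{s \<in> active (Suc n) (append_value n a \<pi>). a < s}
      = Suc ` {s \<in> active n \<pi>. a \<le> s \<and> (s = a \<or> \<pi> n < a \<or> \<pi> n < s)}"
    unfolding active_append_value[OF assms] by auto
  then have "card {s \<in> active (Suc n) (append_value n a \<pi>). a < s}
      = card {s \<in> active n \<pi>. a \<le> s \<and> (s = a \<or> \<pi> n < a \<or> \<pi> n < s)}"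
    by (simp add: card_image)
  also have "\<dots> = (if a \<le> \<pi> n then Suc (upper_sites n \<pi>) else card {s \<in> active n \<pi>. a \<le> s})"
  proof (cases "a \<le> \<pi> n")
    case True
    then have "a \<le> s \<and> (s = a \<or> \<pi> n < a \<or> \<pi> n < s) \<longleftrightarrow> s = a \<or> \<pi> n < s" for s by linarith
    then have "{s \<in> active n \<pi>. a \<le> s \<and> (s = a \<or> \<pi> n < a \<or> \<pi> n < s)}
       = insert a {s \<in> active n \<pi>. \<pi> n < s}" using a by blast
    moreover have "a \<notin> {s \<in> active n \<pi>. \<pi> n < s}" using True by simp
    ultimately show ?thesis using True by (simp add: upper_sites_def)
  next
    case False
    then have "{s \<in> active n \<pi>. a \<le> s \<and> (s = a \<or> \<pi> n < a \<or> \<pi> n < s)}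
       = {s \<in> active n \<pi>. a \<le> s}" by auto
    then show ?thesis using False by simp
  qed
  finally show "upper_sites (Suc n) (append_value n a \<pi>) =
       (if a \<le> \<pi> n then Suc (upper_sites n \<pi>) else card {s \<in> active n \<pi>. a \<le> s})"
    by (simp add: upper_sites_def end_eq)
qed

lemma sum_rank:
  fixes S :: "nat set"
  assumes "finite S"
  shows "(\<Sum>a\<in>S. f (card {s \<in> S. s \<le> a})) = (\<Sum>i=1..card S. f i)"
  using assms
proof (induction rule: finite_linorder_max_induct)
  case empty
  then show ?case by simp
next
  case (insert b A)
  have "{s \<in> insert b A. s \<le> b} = insert b A" using insert by auto
  moreover have "{s \<in> insert b A. s \<le> a} = {s \<in> A. s \<le> a}" if "a \<in> A" for a
    using insert that by auto
  moreover have "b \<notin> A" using insert by auto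
  ultimately show ?case using insert by (simp add: add.commute)
qed

lemma sum_rank_from_top:
  fixes S :: "nat set"
  assumes "finite S"
  shows "(\<Sum>a\<in>S. f (card {s \<in> S. a \<le> s})) = (\<Sum>i=1..card S. f i)"
  using assms
proof (induction rule: finite_linorder_min_induct)
  case empty
  then show ?case by simp
next
  case (insert b A)
  have "{s \<in> insert b A. b \<le> s} = insert b A" using insert by auto
  moreover have "{s \<in> insert b A. a \<le> s} = {s \<in> A. a \<le> s}" if "a \<in> A" for a
    using insert that by auto
  moreover have "b \<notin> A" using insert by auto
  ultimately show ?case using insert by (simp add: add.commute)
qed

lemma sites_pos:
  assumes "\<pi> permutes {1..n}" "1 \<le> n"
  shows "1 \<le> lower_sites n \<pi>" "1 \<le> upper_sites n \<pi>"
proof -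
  have b: "1 \<le> \<pi> j \<and> \<pi> j \<le> n" if "1 \<le> j" "j \<le> n" for j
    using permutes_atLeastAtMost_bounds[OF assms(1)] that by auto
  have "1 \<in> {s \<in> active n \<pi>. s \<le> \<pi> n}"
    using b assms(2) by (fastforce simp: active_def)
  moreover have "\<not> Suc n \<le> \<pi> j" if "1 \<le> i" "i < j" "Suc j \<le> n" for i j
    using b[of j] that by linarith
  then have "Suc n \<in> {s \<in> active n \<pi>. \<pi> n < s}"
    using b[OF assms(2) order_refl] unfolding active_def by auto
  ultimately have "card {s \<in> active n \<pi>. s \<le> \<pi> n} \<noteq> 0" "card {s \<in> active n \<pi>. \<pi> n < s} \<noteq> 0"
    by (auto simp: card_eq_0_iff)
  then show "1 \<le> lower_sites n \<pi>" "1 \<le> upper_sites n \<pi>"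
    unfolding lower_sites_def upper_sites_def by linarith+
qed

text \<open>
  The rewriting rule of the tree, for an arbitrary statistic \<open>f\<close> of the labels: the number of active
  values \<open>\<le> a\<close> runs through \<open>1, \<dots>, h\<close> as \<open>a\<close> runs through the lower active values, and the number
  of active values \<open>\<ge> a\<close> runs through \<open>1, \<dots>, k\<close> as \<open>a\<close> runs through the upper ones.
\<close>

lemma sum_children:
  assumes \<pi>: "\<pi> permutes {1..n}" and n: "1 \<le> n"
  defines "h \<equiv> lower_sites n \<pi>" and "k \<equiv> upper_sites n \<pi>"
  shows "(\<Sum>a\<in>active n \<pi>. f (lower_sites (Suc n) (append_value n a \<pi>))
            (upper_sites (Suc n) (append_value n a \<pi>)))
     = (\<Sum>i=1..h. f i (Suc k)) + (\<Sum>j=1..k. f (Suc (h + k) - j) j)"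
proof -
  let ?A = "active n \<pi>"
  let ?L = "{s \<in> ?A. s \<le> \<pi> n}" and ?U = "{s \<in> ?A. \<pi> n < s}"
  let ?F = "\<lambda>a. f (lower_sites (Suc n) (append_value n a \<pi>)) (upper_sites (Suc n) (append_value n a \<pi>))"
  have "?F a = f (card {s \<in> ?L. s \<le> a}) (Suc k)" if "a \<in> ?L" for a
  proof -
    have "{s \<in> ?A. s \<le> a} = {s \<in> ?L. s \<le> a}" using that by auto
    then show ?thesis using that by (simp add: sites_append_value[OF \<pi> n] k_def)
  qed
  then have L: "sum ?F ?L = (\<Sum>i=1..h. f i (Suc k))"
    using sum_rank[of ?L "\<lambda>i. f i (Suc k)"] by (simp add: h_def lower_sites_def)
  have "?F a = f (Suc (h + k) - card {s \<in> ?U. a \<le> s}) (card {s \<in> ?U. a \<le> s})" if "a \<in> ?U" for a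
  proof -
    have U: "{s \<in> ?A. a \<le> s} = {s \<in> ?U. a \<le> s}" using that by auto
    have "{s \<in> ?A. s \<le> a} \<union> {s \<in> ?A. a \<le> s} = ?L \<union> ?U" by auto
    moreover have "{s \<in> ?A. s \<le> a} \<inter> {s \<in> ?A. a \<le> s} = {a}" using that by auto
    moreover have "?L \<inter> ?U = {}" by auto
    ultimately have "card {s \<in> ?A. s \<le> a} + card {s \<in> ?A. a \<le> s} = Suc (h + k)"
      using card_Un_Int[of "{s \<in> ?A. s \<le> a}" "{s \<in> ?A. a \<le> s}"] card_Un_Int[of ?L ?U]
      by (simp add: h_def k_def lower_sites_def upper_sites_def)
    then have "card {s \<in> ?A. s \<le> a} = Suc (h + k) - card {s \<in> ?A. a \<le> s}" by simp
    then show ?thesis using that by (simp add: sites_append_value[OF \<pi> n] U)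
  qed
  then have U: "sum ?F ?U = (\<Sum>j=1..k. f (Suc (h + k) - j) j)"
    using sum_rank_from_top[of ?U "\<lambda>j. f (Suc (h + k) - j) j"] by (simp add: k_def upper_sites_def)
  have "?A = ?L \<union> ?U" by auto
  then have "sum ?F ?A = sum ?F ?L + sum ?F ?U"
    by (metis (no_types, lifting) finite_active finite_Un sum.union_disjoint disjoint_iff
        mem_Collect_eq not_less)
  then show ?thesis by (simp only: L U)
qed

section \<open>Constant terms of pentagon monomials\<close>

definition ibinom :: "nat \<Rightarrow> int \<Rightarrow> real" where
  "ibinom n k = (if k < 0 then 0 else real (n choose nat k))"

lemma ibinom_neg [simp]: "k < 0 \<Longrightarrow> ibinom n k = 0"
  by (simp add: ibinom_def)

lemma ibinom_of_nat: "ibinom n (int k) = real (n choose k)"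
  by (simp add: ibinom_def)

lemma ibinom_large [simp]: "int n < k \<Longrightarrow> ibinom n k = 0"
  by (simp add: ibinom_def binomial_eq_0 zless_nat_eq_int_zless)

lemma ibinom_Suc: "ibinom (Suc n) k = ibinom n k + ibinom n (k - 1)"
proof (cases "k \<le> 0")
  case True
  then show ?thesis by (cases "k = 0") (auto simp: ibinom_def)
next
  case False
  then have "nat k = Suc (nat (k - 1))" by simp
  then show ?thesis using False by (simp add: ibinom_def)
qed

text \<open>
  The constant term of \<open>x0\<^bsup>e0\<^esup> x1\<^bsup>e1\<^esup> x2\<^bsup>e2\<^esup> x3\<^bsup>e3\<^esup> x4\<^bsup>e4\<^esup>\<close>, that is, the coefficient of
  \<open>u\<^bsup>e3 + e4 - e1\<^esup> v\<^bsup>e0 + e4 - e2\<^esup>\<close> in \<open>(1 + u)\<^bsup>e0\<^esup> (1 + v)\<^bsup>e3\<^esup> (1 + u + v)\<^bsup>e4\<^esup>\<close>, obtained by expanding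
  the last factor in powers of \<open>1 + u\<close> and \<open>v\<close>. The variables \<open>x1 = u\<close> and \<open>x2 = v\<close> are invertible,
  so their exponents may be negative; this is needed for the labels with \<open>h > m\<close>.
\<close>

definition CT :: "nat \<Rightarrow> int \<Rightarrow> int \<Rightarrow> nat \<Rightarrow> nat \<Rightarrow> real" where
  "CT e0 e1 e2 e3 e4 =
     (\<Sum>l\<le>e4. ibinom e4 (int l) * ibinom (e0 + l) (int e3 + int e4 - e1)
        * ibinom e3 (int e0 - e2 + int l))"

text \<open>
  The exchange relations \<open>x(i-1) x(i+1) = 1 + x(i)\<close> for \<open>i = 2, 1, 3\<close>, read off on constant terms. They
  come from Pascal's rule for the binomial coefficients with upper index \<open>e3\<close>, \<open>e0 + l\<close> and \<open>e4\<close>,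
  respectively.
\<close>

lemma CT_exchange_2: "CT e0 (e1 + 1) e2 (Suc e3) e4 = CT e0 e1 e2 e3 e4 + CT e0 e1 (e2 + 1) e3 e4"
proof -
  have *: "int (Suc e3) + int e4 - (e1 + 1) = int e3 + int e4 - e1"
     "int e0 - (e2 + 1) + int l = int e0 - e2 + int l - 1" for l by simp_all
  show ?thesis
    unfolding CT_def * ibinom_Suc by (simp add: sum.distrib algebra_simps)
qed

lemma CT_exchange_1: "CT (Suc e0) e1 (e2 + 1) e3 e4 = CT e0 e1 e2 e3 e4 + CT e0 (e1 + 1) e2 e3 e4"
proof -
  have *: "int (Suc e0) - (e2 + 1) + int l = int e0 - e2 + int l"
     "int e3 + int e4 - (e1 + 1) = int e3 + int e4 - e1 - 1" for l by simp_all
  show ?thesis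
    unfolding CT_def * add_Suc ibinom_Suc by (simp add: sum.distrib algebra_simps)
qed

lemma sum_ibinom_Suc:
  "(\<Sum>l\<le>Suc n. ibinom (Suc n) (int l) * f l) = (\<Sum>l\<le>n. ibinom n (int l) * (f l + f (Suc l)))"
proof -
  have "(\<Sum>l\<le>Suc n. ibinom (Suc n) (int l) * f l)
      = (\<Sum>l\<le>Suc n. ibinom n (int l) * f l) + (\<Sum>l\<le>Suc n. ibinom n (int l - 1) * f l)"
    by (simp add: ibinom_Suc sum.distrib algebra_simps)
  also have "(\<Sum>l\<le>Suc n. ibinom n (int l) * f l) = (\<Sum>l\<le>n. ibinom n (int l) * f l)"
    by simp
  also have "(\<Sum>l\<le>Suc n. ibinom n (int l - 1) * f l) = (\<Sum>l\<le>n. ibinom n (int l) * f (Suc l))"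
    by (subst sum.atMost_Suc_shift) simp
  finally show ?thesis by (simp add: sum.distrib algebra_simps)
qed

lemma CT_exchange_3: "CT e0 e1 (e2 + 1) e3 (Suc e4) = CT e0 e1 e2 e3 e4 + CT e0 e1 e2 (Suc e3) e4"
proof -
  let ?P = "int e3 + int e4 - e1" and ?R = "int e0 - e2"
  have "CT e0 e1 (e2 + 1) e3 (Suc e4) = (\<Sum>l\<le>Suc e4. ibinom (Suc e4) (int l)
      * (ibinom (e0 + l) (?P + 1) * ibinom e3 (?R + int l - 1)))"
    unfolding CT_def by (rule sum.cong) (auto simp: algebra_simps)
  also have "\<dots> = (\<Sum>l\<le>e4. ibinom e4 (int l) * (ibinom (e0 + l) (?P + 1) * ibinom e3 (?R + int l - 1)
       + ibinom (e0 + Suc l) (?P + 1) * ibinom e3 (?R + int (Suc l) - 1)))"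
    by (rule sum_ibinom_Suc)
  also have "\<dots> = (\<Sum>l\<le>e4. ibinom e4 (int l) * ibinom (e0 + l) ?P * ibinom e3 (?R + int l)
       + ibinom e4 (int l) * ibinom (e0 + l) (?P + 1) * ibinom (Suc e3) (?R + int l))"
    by (rule sum.cong) (simp_all add: ibinom_Suc algebra_simps)
  also have "\<dots> = CT e0 e1 e2 e3 e4 + CT e0 e1 e2 (Suc e3) e4"
    unfolding CT_def sum.distrib by (simp add: algebra_simps)
  finally show ?thesis .
qed

text \<open>
  Expanding \<open>(1 + u + v)\<^bsup>e4\<^esup>\<close> in powers of \<open>u\<close> and \<open>1 + v\<close> instead gives the same constant term. The
  reflection fixing \<open>x2\<close> is a mere reindexing in this form, as the one fixing \<open>x1\<close> is in the
  form of the definition.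
\<close>

lemma CT_expand_other:
  "CT e0 e1 e2 e3 e4 = (\<Sum>l\<le>e4. ibinom e4 (int l) * ibinom (e3 + l) (int e0 + int e4 - e2)
        * ibinom e0 (int e3 - e1 + int l))"
proof (induction e4 arbitrary: e2 e3)
  case 0
  show ?case by (simp add: CT_def)
next
  case (Suc e4)
  let ?g = "\<lambda>l. ibinom (e3 + l) (int e0 + int (Suc e4) - e2) * ibinom e0 (int e3 - e1 + int l)"
  have "CT e0 e1 e2 e3 (Suc e4) = CT e0 e1 (e2 - 1) e3 e4 + CT e0 e1 (e2 - 1) (Suc e3) e4"
    using CT_exchange_3[of e0 e1 "e2 - 1" e3 e4] by simp
  also have "\<dots> = (\<Sum>l\<le>e4. ibinom e4 (int l) * (?g l + ?g (Suc l)))"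
    unfolding Suc.IH by (simp add: sum.distrib algebra_simps)
  also have "\<dots> = (\<Sum>l\<le>Suc e4. ibinom (Suc e4) (int l) * ?g l)"
    by (rule sum_ibinom_Suc[symmetric])
  finally show ?case by (simp add: mult.assoc)
qed

lemma sum_int_shift:
  fixes g :: "int \<Rightarrow> real"
  assumes "\<And>i. g i \<noteq> 0 \<Longrightarrow> 0 \<le> i \<and> i \<le> int n \<and> 0 \<le> i + d \<and> i + d \<le> int m"
  shows "(\<Sum>l\<le>n. g (int l)) = (\<Sum>l\<le>m. g (int l - d))"
proof -
  have int_image: "int ` {..n} = {0..int n}"
    by (simp add: image_int_atLeastAtMost atMost_atLeast0)
  have "(\<lambda>l. int l - d) ` {..m} = (\<lambda>i. i - d) ` int ` {..m}"
    by (simp add: image_image)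
  also have "\<dots> = {-d..int m - d}"
    by (simp add: image_int_atLeastAtMost atMost_atLeast0)
  finally have shift_image: "(\<lambda>l. int l - d) ` {..m} = {-d..int m - d}" .
  have "(\<Sum>l\<le>n. g (int l)) = sum g {0..int n}"
    by (simp add: sum.reindex inj_on_def flip: int_image)
  also have "\<dots> = sum g ({0..int n} \<inter> {-d..int m - d})"
    by (rule sum.mono_neutral_right) (use assms in force)+
  also have "\<dots> = sum g {-d..int m - d}"
    by (rule sum.mono_neutral_left) (use assms in force)+
  also have "\<dots> = (\<Sum>l\<le>m. g (int l - d))"
    by (simp add: sum.reindex inj_on_def flip: shift_image)
  finally show ?thesis .
qed

text \<open>
  The reflections \<open>i \<mapsto> 2 - i\<close>, \<open>i \<mapsto> 4 - i\<close> and \<open>i \<mapsto> - i\<close> of the indices modulo 5. A variable that is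
  exchanged with another one must have an exponent that is allowed in both places, hence the natural
  numbers; the exponent of the fixed variable \<open>x1\<close> or \<open>x2\<close> is arbitrary.
\<close>

lemma CT_reflect_1:
  "CT e0 e1 (int e2) e3 e4 = CT e2 e1 (int e0) e4 e3"
proof -
  define d where "d = int e0 - int e2"
  let ?P = "int e3 + int e4 - e1"
  let ?g = "\<lambda>i. ibinom e4 i * ibinom (nat (int e0 + i)) ?P * ibinom e3 (d + i)"
  have "CT e0 e1 (int e2) e3 e4 = (\<Sum>l\<le>e4. ?g (int l))"
    by (simp add: CT_def d_def nat_int_add)
  also have "\<dots> = (\<Sum>l\<le>e3. ?g (int l - d))"
    by (rule sum_int_shift) (auto simp: ibinom_def algebra_simps split: if_splits)
  also have "\<dots> = CT e2 e1 (int e0) e4 e3"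
    unfolding CT_def by (rule sum.cong) (auto simp: d_def nat_int_add algebra_simps)
  finally show ?thesis .
qed

lemma CT_reflect_2: "CT e0 (int e1) e2 e3 e4 = CT e4 (int e3) e2 e1 e0"
proof -
  define d where "d = int e3 - int e1"
  let ?P = "int e0 + int e4 - e2"
  let ?g = "\<lambda>i. ibinom e4 i * ibinom (nat (int e3 + i)) ?P * ibinom e0 (d + i)"
  have "CT e0 (int e1) e2 e3 e4 = (\<Sum>l\<le>e4. ?g (int l))"
    by (simp add: CT_expand_other d_def nat_int_add)
  also have "\<dots> = (\<Sum>l\<le>e0. ?g (int l - d))"
    by (rule sum_int_shift) (auto simp: ibinom_def algebra_simps split: if_splits)
  also have "\<dots> = CT e4 (int e3) e2 e1 e0"
    unfolding CT_expand_other by (rule sum.cong) (auto simp: d_def nat_int_add algebra_simps)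
  finally show ?thesis .
qed

lemma CT_reflect_0: "CT e0 (int e1) (int e2) e3 e4 = CT e0 (int e4) (int e3) e2 e1"
  \<comment> \<open>Conjugating \<open>i \<mapsto> 4 - i\<close> by \<open>i \<mapsto> 2 - i\<close> gives \<open>i \<mapsto> - i\<close>.\<close>
  by (subst CT_reflect_1, subst CT_reflect_2, rule CT_reflect_1)

section \<open>Counting descendants by alternating constant terms\<close>

text \<open>
  The constant term of the monomial multiplied by the alternating polynomial
  \<open>\<Sum>i. x(i)\<^sup>2 x(i+1) - x(i) x(i+1)\<^sup>2\<close>, which changes its sign under every reflection of the pentagon.
\<close>

definition CT_alt :: "nat \<Rightarrow> int \<Rightarrow> int \<Rightarrow> nat \<Rightarrow> nat \<Rightarrow> real" where
  "CT_alt e0 e1 e2 e3 e4 =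
      (CT (e0 + 2) (e1 + 1) e2 e3 e4 - CT (e0 + 1) (e1 + 2) e2 e3 e4)
    + (CT e0 (e1 + 2) (e2 + 1) e3 e4 - CT e0 (e1 + 1) (e2 + 2) e3 e4)
    + (CT e0 e1 (e2 + 2) (e3 + 1) e4 - CT e0 e1 (e2 + 1) (e3 + 2) e4)
    + (CT e0 e1 e2 (e3 + 2) (e4 + 1) - CT e0 e1 e2 (e3 + 1) (e4 + 2))
    + (CT (e0 + 1) e1 e2 e3 (e4 + 2) - CT (e0 + 2) e1 e2 e3 (e4 + 1))"

lemma CT_alt_exchange_1:
  "CT_alt (Suc e0) e1 (e2 + 1) e3 e4 = CT_alt e0 e1 e2 e3 e4 + CT_alt e0 (e1 + 1) e2 e3 e4"
proof -
  have "CT (Suc e0 + i) (e1 + j) (e2 + 1 + k) (e3 + l) (e4 + m)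
     = CT (e0 + i) (e1 + j) (e2 + k) (e3 + l) (e4 + m) + CT (e0 + i) (e1 + 1 + j) (e2 + k) (e3 + l) (e4 + m)"
    for i j k l m
    using CT_exchange_1[of "e0 + i" "e1 + j" "e2 + k" "e3 + l" "e4 + m"] by (simp add: ac_simps)
  from this[of 2 1 0 0 0] this[of 1 2 0 0 0] this[of 0 2 1 0 0] this[of 0 1 2 0 0]
       this[of 0 0 2 1 0] this[of 0 0 1 2 0] this[of 0 0 0 2 1] this[of 0 0 0 1 2]
       this[of 1 0 0 0 2] this[of 2 0 0 0 1]
  show ?thesis unfolding CT_alt_def by (simp only: add_0_right)
qed

lemma CT_alt_exchange_2:
  "CT_alt e0 (e1 + 1) e2 (Suc e3) e4 = CT_alt e0 e1 e2 e3 e4 + CT_alt e0 e1 (e2 + 1) e3 e4"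
proof -
  have "CT (e0 + i) (e1 + 1 + j) (e2 + k) (Suc e3 + l) (e4 + m)
     = CT (e0 + i) (e1 + j) (e2 + k) (e3 + l) (e4 + m) + CT (e0 + i) (e1 + j) (e2 + 1 + k) (e3 + l) (e4 + m)"
    for i j k l m
    using CT_exchange_2[of "e0 + i" "e1 + j" "e2 + k" "e3 + l" "e4 + m"] by (simp add: ac_simps)
  from this[of 2 1 0 0 0] this[of 1 2 0 0 0] this[of 0 2 1 0 0] this[of 0 1 2 0 0]
       this[of 0 0 2 1 0] this[of 0 0 1 2 0] this[of 0 0 0 2 1] this[of 0 0 0 1 2]
       this[of 1 0 0 0 2] this[of 2 0 0 0 1]
  show ?thesis unfolding CT_alt_def by (simp only: add_0_right)
qed

lemma CT_alt_exchange_3: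
  "CT_alt e0 e1 (e2 + 1) e3 (Suc e4) = CT_alt e0 e1 e2 e3 e4 + CT_alt e0 e1 e2 (Suc e3) e4"
proof -
  have "CT (e0 + i) (e1 + j) (e2 + 1 + k) (e3 + l) (Suc e4 + m)
     = CT (e0 + i) (e1 + j) (e2 + k) (e3 + l) (e4 + m) + CT (e0 + i) (e1 + j) (e2 + k) (Suc e3 + l) (e4 + m)"
    for i j k l m
    using CT_exchange_3[of "e0 + i" "e1 + j" "e2 + k" "e3 + l" "e4 + m"] by (simp add: ac_simps)
  from this[of 2 1 0 0 0] this[of 1 2 0 0 0] this[of 0 2 1 0 0] this[of 0 1 2 0 0]
       this[of 0 0 2 1 0] this[of 0 0 1 2 0] this[of 0 0 0 2 1] this[of 0 0 0 1 2]
       this[of 1 0 0 0 2] this[of 2 0 0 0 1]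
  show ?thesis unfolding CT_alt_def by (simp only: add_0_right)
qed

text \<open>
  A monomial that is invariant under a reflection becomes anti-invariant when multiplied by the
  alternating polynomial, so the ten terms cancel in pairs.
\<close>

lemma CT_alt_reflect_0: "CT_alt e0 (int a) (int b) b a = 0"
proof -
  have "CT (e0 + i) (int a + int j) (int b + int k) (b + l) (a + m)
      = CT (e0 + i) (int a + int m) (int b + int l) (b + k) (a + j)" for i j k l m
    using CT_reflect_0[of "e0 + i" "a + j" "b + k" "b + l" "a + m"] by simp
  from this[of 2 1 0 0 0] this[of 1 2 0 0 0] this[of 0 2 1 0 0] this[of 0 1 2 0 0]
       this[of 0 0 2 1 0]
  show ?thesis unfolding CT_alt_def by (simp flip: of_nat_add)
qed

lemma CT_alt_reflect_2: "CT_alt a (int b) e2 b a = 0"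
proof -
  have "CT (a + i) (int b + int j) (e2 + k) (b + l) (a + m)
      = CT (a + m) (int b + int l) (e2 + k) (b + j) (a + i)" for i j k l m
    using CT_reflect_2[of "a + i" "b + j" "e2 + k" "b + l" "a + m"] by simp
  from this[of 2 1 0 0 0] this[of 1 2 0 0 0] this[of 0 2 1 0 0] this[of 0 1 2 0 0]
       this[of 1 0 0 0 2]
  show ?thesis unfolding CT_alt_def by simp
qed

text \<open>
  The constant term of \<open>L\<^sup>m A y\<^sup>h z\<^sup>k x0 / (x1 x3)\<close>, where \<open>L\<close> is the product of the five variables, \<open>A\<close>
  the alternating polynomial, \<open>y = x1 x3 / x2\<close> and \<open>z = x1 x4\<close>. It is the number of nodes \<open>m + 1\<close> levels
  below a node with label \<open>(h, k)\<close>, for \<open>h, k \<ge> 1\<close>.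
\<close>

definition descendants :: "nat \<Rightarrow> nat \<Rightarrow> nat \<Rightarrow> real" where
  "descendants m h k =
     CT_alt (m + 1) (int m + int h + int k - 1) (int m - int h) (m + h - 1) (m + k)"

text \<open>
  With \<open>F = L\<^sup>m A x0 / (x1 x3)\<close>, the auxiliary \<open>X i\<close> and \<open>Z j\<close> are the constant terms of
  \<open>F y\<^bsup>i + 1\<^esup> z\<^bsup>k + 1\<^esup> x2\<close> and \<open>F y\<^bsup>h + k + 1 - j\<^esup> z\<^bsup>j + 1\<^esup> x2 / x1\<close>. Their increments are the constant terms
  for the children, because \<open>x2 (y - 1) = 1\<close> and \<open>(x2 / x1) (z - y) = 1\<close>; \<open>X 0\<close> and \<open>Z 0\<close> vanish by
  antisymmetry; and \<open>X h + Z k\<close> belongs to \<open>y\<^bsup>h + 1\<^esup> z\<^bsup>k + 1\<^esup> x2 (1 + 1 / x1) = L y\<^sup>h z\<^sup>k\<close>.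
\<close>

lemma descendants_Suc:
  assumes "1 \<le> h"
  shows "descendants (Suc m) h k =
    (\<Sum>i=1..h. descendants m i (Suc k)) + (\<Sum>j=1..k. descendants m (Suc (h + k) - j) j)"
proof -
  define X where "X i = CT_alt (m + 1) (int m + int i + int k + 1) (int m - int i) (m + i) (m + k + 1)" for i
  define Z where "Z j = CT_alt (m + 1) (int m + int (h + k)) (int m - int (h + k) + int j)
      (m + (h + k - j)) (m + 1 + j)" for j
  have X_step: "X (Suc i) = descendants m (Suc i) (Suc k) + X i" for i
    using CT_alt_exchange_2[of "m + 1" "int m + int i + int k + 1" "int m - int i - 1" "m + i" "m + k + 1"]
    by (simp add: X_def descendants_def algebra_simps)
  have X_0: "X 0 = 0"
    using CT_alt_reflect_0[of "m + 1" "m + k + 1" m] by (simp add: X_def algebra_simps)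
  have "X i = (\<Sum>i=1..i. descendants m i (Suc k))" for i
    by (induction i) (simp_all add: X_0 X_step)
  then have X: "X h = (\<Sum>i=1..h. descendants m i (Suc k))" .
  have Z_step: "Z (Suc j) = descendants m (h + k - j) (Suc j) + Z j" if jk: "Suc j \<le> k" for j
  proof -
    obtain d where d: "h + k = Suc (j + d)" using le_Suc_ex[OF trans_le_add2[OF jk, of h]] by auto
    show ?thesis
      using CT_alt_exchange_3[of "m + 1" "int m + 1 + int j + int d" "int m - 1 - int d" "m + d" "m + 1 + j"]
      by (simp add: Z_def descendants_def d algebra_simps)
  qed
  have Z_0: "Z 0 = 0"
    using CT_alt_reflect_2[of "m + 1" "m + h + k"] by (simp add: Z_def algebra_simps)
  have "j \<le> k \<Longrightarrow> Z j = (\<Sum>j=1..j. descendants m (Suc (h + k) - j) j)" for j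
    by (induction j) (simp_all add: Z_0 Z_step)
  then have Z: "Z k = (\<Sum>j=1..k. descendants m (Suc (h + k) - j) j)" by simp
  have "descendants (Suc m) h k = Z k + X h"
    using CT_alt_exchange_1[of "m + 1" "int m + int h + int k" "int m - int h" "m + h" "m + k + 1"]
    by (simp add: X_def Z_def descendants_def algebra_simps)
  with X Z show ?thesis by simp
qed

text \<open>
  If \<open>e2 + e3 - e0\<close> is negative, 0 or 1, the sum for the constant term has no, one or two summands.
  These cases evaluate all ten terms at depth one.
\<close>

lemma CT_eq_0: "int e3 + e2 < int e0 \<Longrightarrow> CT e0 e1 e2 e3 e4 = 0"
  unfolding CT_def by (rule sum.neutral) simp

lemma CT_single:
  assumes "e2 + int e3 = int e0"
  shows "CT e0 e1 e2 e3 e4 = ibinom e0 (int e3 + int e4 - e1)"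
proof -
  have "CT e0 e1 e2 e3 e4 = (\<Sum>l\<in>{0}. ibinom e4 (int l) * ibinom (e0 + l) (int e3 + int e4 - e1)
        * ibinom e3 (int e0 - e2 + int l))"
    unfolding CT_def by (rule sum.mono_neutral_right) (use assms in auto)
  also have "int e0 - e2 = int e3" using assms by simp
  finally show ?thesis using ibinom_of_nat[of e3 e3] ibinom_of_nat[of e4 0] by simp
qed

lemma CT_double:
  assumes "e2 + int e3 = int e0 + 1"
  shows "CT e0 e1 e2 e3 e4 = real e3 * ibinom e0 (int e3 + int e4 - e1) +
     real e4 * ibinom (Suc e0) (int e3 + int e4 - e1)"
proof -
  let ?t = "\<lambda>l. ibinom e4 (int l) * ibinom (e0 + l) (int e3 + int e4 - e1)
        * ibinom e3 (int e0 - e2 + int l)"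
  have "CT e0 e1 e2 e3 e4 = sum ?t {..e4}" by (simp add: CT_def)
  also have "\<dots> = sum ?t ({..e4} \<union> {0, 1})"
    by (rule sum.mono_neutral_left) auto
  also have "\<dots> = sum ?t {0, 1}"
    by (rule sum.mono_neutral_right) (use assms in auto)
  also have "\<dots> = ?t 0 + ?t 1" by simp
  also have "int e0 - e2 + int 0 = int e3 - 1" using assms by simp
  also have "int e0 - e2 + int 1 = int e3" using assms by simp
  also have "ibinom e3 (int e3 - 1) = real e3" by (cases e3) (simp_all add: ibinom_def)
  finally show ?thesis by (simp add: ibinom_def)
qed

lemma descendants_0:
  assumes "1 \<le> h" "1 \<le> k"
  shows "descendants 0 h k = real h + real k"
proof -
  obtain g where h: "h = Suc g" using assms by (cases h) auto
  have [simp]: "ibinom (Suc 0) 1 = 1" "ibinom (Suc 0) 2 = 0" "ibinom (Suc (Suc 0)) 2 = 1"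
      "ibinom (Suc 0) 3 = 0" "ibinom (Suc (Suc 0)) 1 = 2"
    by (simp_all add: ibinom_def numeral_2_eq_2)
  show ?thesis
    unfolding descendants_def CT_alt_def h
    by (simp add: CT_eq_0 CT_single CT_double)
qed

section \<open>Semi-Baxter numbers as constant terms\<close>

text \<open>
  The same permutations, grouped by their ancestors of size \<open>n + 1\<close> or of size \<open>n\<close>.
\<close>

lemma sum_descendants:
  assumes "1 \<le> n"
  shows "(\<Sum>\<pi> | semi_baxter (Suc n) \<pi>. descendants m (lower_sites (Suc n) \<pi>) (upper_sites (Suc n) \<pi>))
    = (\<Sum>\<pi> | semi_baxter n \<pi>. descendants (Suc m) (lower_sites n \<pi>) (upper_sites n \<pi>))"
  unfolding sum_semi_baxter_Suc
proof (rule sum.cong[OF refl])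
  fix \<pi> assume "\<pi> \<in> {\<pi>. semi_baxter n \<pi>}"
  then have \<pi>: "\<pi> permutes {1..n}" by (simp add: semi_baxter_def)
  show "(\<Sum>a\<in>active n \<pi>. descendants m (lower_sites (Suc n) (append_value n a \<pi>))
          (upper_sites (Suc n) (append_value n a \<pi>)))
      = descendants (Suc m) (lower_sites n \<pi>) (upper_sites n \<pi>)"
    unfolding descendants_Suc[OF sites_pos(1)[OF \<pi> assms]] by (rule sum_children[OF \<pi> assms])
qed

lemma semi_baxter_1: "{\<pi>. semi_baxter 1 \<pi>} = {id}"
  by (auto simp: semi_baxter_iff permutes_sing)

lemma sites_1: "lower_sites 1 id = 1" "upper_sites 1 id = 1"
proof -
  have "active 1 id = {1, 2}" by (auto simp: active_def)
  then have "{s \<in> active 1 id. s \<le> id 1} = {1}" "{s \<in> active 1 id. id 1 < s} = {2}" by auto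
  then show "lower_sites 1 id = 1" "upper_sites 1 id = 1"
    by (simp_all add: lower_sites_def upper_sites_def)
qed

lemma SB_Suc:
  assumes "1 \<le> n"
  shows "real (SB (Suc n)) = (\<Sum>\<pi> | semi_baxter n \<pi>. descendants 0 (lower_sites n \<pi>) (upper_sites n \<pi>))"
proof -
  have "real (SB (Suc n)) = (\<Sum>\<pi> | semi_baxter (Suc n) \<pi>. 1)"
    by (simp add: SB_def)
  also have "\<dots> = (\<Sum>\<pi> | semi_baxter n \<pi>. real (card (active n \<pi>)))"
    unfolding sum_semi_baxter_Suc by simp
  also have "\<dots> = (\<Sum>\<pi> | semi_baxter n \<pi>. descendants 0 (lower_sites n \<pi>) (upper_sites n \<pi>))"
  proof (rule sum.cong[OF refl])
    fix \<pi> assume "\<pi> \<in> {\<pi>. semi_baxter n \<pi>}"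
    then have \<pi>: "\<pi> permutes {1..n}" by (simp add: semi_baxter_def)
    have "active n \<pi> = {s \<in> active n \<pi>. s \<le> \<pi> n} \<union> {s \<in> active n \<pi>. \<pi> n < s}" by auto
    then have "card (active n \<pi>) = lower_sites n \<pi> + upper_sites n \<pi>"
      unfolding lower_sites_def upper_sites_def
      by (subst card_Un_disjoint[symmetric]) auto
    then show "real (card (active n \<pi>)) = descendants 0 (lower_sites n \<pi>) (upper_sites n \<pi>)"
      by (simp only: descendants_0[OF sites_pos[OF \<pi> assms]] of_nat_add)
  qed
  finally show ?thesis .
qed

text \<open>
  All permutations of size \<open>m + 2\<close> are descendants, \<open>m + 1\<close> levels down, of the permutation of size 1.
\<close>

theorem SB_eq_CT_alt:
  "real (SB (m + 2)) = CT_alt (m + 1) (int m + 1) (int m - 1) m (m + 1)"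
proof -
  have "real (SB (n + m + 2)) = (\<Sum>\<pi> | semi_baxter (Suc n) \<pi>.
      descendants m (lower_sites (Suc n) \<pi>) (upper_sites (Suc n) \<pi>))" for n
  proof (induction m arbitrary: n)
    case 0
    show ?case using SB_Suc[of "Suc n"] by simp
  next
    case (Suc m)
    show ?case using Suc.IH[of "Suc n"] sum_descendants[of "Suc n" m] by simp
  qed
  from this[of 0] show ?thesis
    using semi_baxter_1 sites_1 by (simp add: descendants_def algebra_simps)
qed

section \<open>Telescoping to the numbers \<open>a\<^sub>n\<close>\<close>

text \<open>
  The reciprocal factorial, extended by 0 so that its recurrence holds at all integers. Binomial
  coefficients thereby become products without side conditions on the lower index, and every shift of
  an argument becomes a polynomial factor, also at the ends of the summation range.
\<close>

definition rfact :: "int \<Rightarrow> real" where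
  "rfact x = (if x < 0 then 0 else inverse (fact (nat x)))"

lemma rfact_step: "rfact (x - 1) = of_int x * rfact x"
proof (cases "x \<le> 0")
  case True
  then show ?thesis by (cases "x = 0") (auto simp: rfact_def)
next
  case False
  then have "nat x = Suc (nat (x - 1))" by simp
  then show ?thesis using False by (simp add: rfact_def field_simps)
qed

lemma rfact_diff: "rfact (x - int k) = pochhammer (of_int x - of_nat k + 1) k * rfact x"
proof (induction k)
  case (Suc k)
  have "rfact (x - int (Suc k)) = of_int (x - int k) * rfact (x - int k)"
    using rfact_step[of "x - int k"] by (simp add: algebra_simps)
  then show ?case
    unfolding Suc.IH pochhammer_rec by (simp add: algebra_simps)
qed simp

lemma ibinom_rfact: "ibinom n k = fact n * rfact k * rfact (int n - k)"
proof (cases "0 \<le> k \<and> k \<le> int n")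
  case True
  then have "nat (int n - k) = n - nat k" "nat k \<le> n" by auto
  then show ?thesis using True by (simp add: ibinom_def rfact_def binomial_fact field_simps)
next
  case False
  then show ?thesis by (cases "k < 0") (auto simp: rfact_def)
qed

lemma fact_add: "fact (n + k) = pochhammer (of_nat n + 1) k * (fact n :: real)"
  by (induction k) (simp_all add: pochhammer_Suc algebra_simps)

text \<open>
  The common hypergeometric term, for \<open>n = m + 2\<close>. The offsets are chosen such that the
  summands of all twelve sums below are polynomial multiples of it, once three of the sums have been
  shifted.
\<close>

definition base_term :: "nat \<Rightarrow> nat \<Rightarrow> real" where
  "base_term m l = fact m * fact (m + 1) * rfact (int m + 3) * fact (m + 1 + l)
     * rfact (int l) * rfact (int l + 2) * rfact (int l + 3) * rfact (int m + 3 - int l) ^ 2"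

text \<open>
  The polynomial in \<open>n\<close> and in the summation index \<open>x\<close> by which a summand of a constant term, shifted by
  \<open>s\<close>, differs from \<open>base_term\<close>. Each Pochhammer symbol compares one factorial of the summand with its
  counterpart there. The parameters are offsets of the exponents, as in the assumptions of
  \<open>CT_eq_sum_base_term\<close>; \<open>t2\<close> and \<open>t3\<close> are the offsets 2 and 3 of \<open>base_term\<close> in either order.
\<close>

definition cofactor ::
  "nat \<Rightarrow> nat \<Rightarrow> nat \<Rightarrow> nat \<Rightarrow> nat \<Rightarrow> nat \<Rightarrow> nat \<Rightarrow> nat \<Rightarrow> real \<Rightarrow> real \<Rightarrow> real" where
  "cofactor s w c3 c4 p t2 t3 a n x =
     pochhammer (x + 1 - real s) s * pochhammer (x + real w + real p - 1) (t2 + 2 - w - p)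
   * pochhammer (x + real t3 - real a + 1) a * pochhammer (n - x + real c4 + real s) (2 - c4 - s)
   * pochhammer (n - x + real c3 + real a - real t3 - 1) (3 + t3 - c3 - a)
   * pochhammer (n + x) w * pochhammer (n - 1) c3 * pochhammer n c4 * pochhammer (n + 2 - real p) p"

lemma CT_eq_sum_base_term:
  fixes m s w c3 c4 p t2 t3 a :: nat
  assumes exps: "e0 = m + 1 + s + w" "e1 = int m + int c3 + int c4 + int p - 2"
      "e2 = int m + 1 + int w + int a - int t3" "e3 = m + c3" "e4 = m + 1 + c4"
    and le: "c4 + s \<le> 2" "w + p \<le> t2 + 2" "c3 + a \<le> 3 + t3"
    and tops: "{t2, t3} = {2, 3}"
  shows "CT e0 e1 e2 e3 e4 = (\<Sum>l\<le>m + 3. base_term m l * cofactor s w c3 c4 p t2 t3 a (real m + 2) (real l))"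
proof -
  let ?P = "int e3 + int e4 - e1" and ?R = "int e0 - e2"
  let ?g = "\<lambda>i. ibinom e4 i * ibinom (nat (int e0 + i)) ?P * ibinom e3 (?R + i)"
  have "CT e0 e1 e2 e3 e4 = (\<Sum>l\<le>e4. ?g (int l))"
    by (simp add: CT_def nat_int_add)
  also have "\<dots> = (\<Sum>l\<le>m + 3. ?g (int l - int s))"
    by (rule sum_int_shift) (use exps le in \<open>auto simp: ibinom_def split: if_splits\<close>)
  also have "\<dots> = (\<Sum>l\<le>m + 3. base_term m l * cofactor s w c3 c4 p t2 t3 a (real m + 2) (real l))"
  proof (rule sum.cong[OF refl])
    fix l
    let ?l = "int l"
    have P: "?P = int m + 3 - int p" and R: "?R + (?l - int s) = ?l + int t3 - int a"
      using exps by simp_all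
    have e0: "nat (int e0 + (?l - int s)) = (m + 1 + l) + w" using exps by simp
    have low: "rfact (?l - int s) = pochhammer (real l + 1 - real s) s * rfact ?l"
        "rfact (int (m + 1 + l + w) - ?P)
          = pochhammer (real l + real w + real p - 1) (t2 + 2 - w - p) * rfact (?l + int t2)"
        "rfact (?l + int t3 - int a) = pochhammer (real l + real t3 - real a + 1) a * rfact (?l + int t3)"
      using rfact_diff[of ?l s] rfact_diff[of "?l + int t2" "t2 + 2 - w - p"]
        rfact_diff[of "?l + int t3" a] le
      by (simp_all add: P of_nat_diff algebra_simps)
    have up: "rfact (int e4 - (?l - int s))
          = pochhammer (real m + 2 - real l + real c4 + real s) (2 - c4 - s) * rfact (int m + 3 - ?l)"
        "rfact (int e3 - (?l + int t3 - int a))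
          = pochhammer (real m + 2 - real l + real c3 + real a - real t3 - 1) (3 + t3 - c3 - a)
            * rfact (int m + 3 - ?l)"
      using rfact_diff[of "int m + 3 - ?l" "2 - c4 - s"] rfact_diff[of "int m + 3 - ?l" "3 + t3 - c3 - a"]
        le exps
      by (simp_all add: of_nat_diff algebra_simps)
    have const_P: "rfact ?P = pochhammer (real m + 2 + 2 - real p) p * rfact (int m + 3)"
      unfolding P using rfact_diff[of "int m + 3" p] by (simp add: algebra_simps)
    have const: "fact e3 = pochhammer (real m + 2 - 1) c3 * (fact m :: real)"
        "fact e4 = pochhammer (real m + 2) c4 * (fact (m + 1) :: real)"
        "fact (m + 1 + l + w) = pochhammer (real m + 2 + real l) w * (fact (m + 1 + l) :: real)"
      unfolding exps fact_add by (simp_all add: algebra_simps del: fact_Suc)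
    have tops': "rfact (?l + int t2) * rfact (?l + int t3) = rfact (?l + 2) * rfact (?l + 3)"
      using tops by (auto simp: doubleton_eq_iff)
    have "?g (?l - int s) = (fact e4 * rfact (?l - int s) * rfact (int e4 - (?l - int s)))
        * (fact (m + 1 + l + w) * rfact ?P * rfact (int (m + 1 + l + w) - ?P))
        * (fact e3 * rfact (?l + int t3 - int a) * rfact (int e3 - (?l + int t3 - int a)))"
      unfolding e0 R ibinom_rfact ..
    also have "\<dots> = (rfact (?l + int t2) * rfact (?l + int t3)) * (fact m * fact (m + 1) * rfact (int m + 3)
        * fact (m + 1 + l) * rfact ?l * rfact (int m + 3 - ?l) ^ 2)
        * cofactor s w c3 c4 p t2 t3 a (real m + 2) (real l)"
      unfolding low up const_P const cofactor_def power2_eq_square by (simp only: mult_ac)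
    also have "\<dots> = base_term m l * cofactor s w c3 c4 p t2 t3 a (real m + 2) (real l)"
      unfolding tops' base_term_def by (simp only: mult_ac)
    finally show "?g (?l - int s) = base_term m l * cofactor s w c3 c4 p t2 t3 a (real m + 2) (real l)" .
  qed
  finally show ?thesis .
qed

text \<open>
  The polynomial solution of Gosper's equation stated in \<open>cofactor_identity\<close>, up to the factor
  \<open>n\<^sup>2 (n - 1)\<close>. Comparing powers of \<open>x\<close> there gives a system of linear equations for its coefficients.
\<close>

definition certificate :: "real \<Rightarrow> real \<Rightarrow> real" where
  "certificate n x = (- 10*n^5 - 140*n^4 - 770*n^3 - 2080*n^2 - 2760*n - 1440) * x^7
    + (10*n^7 + 140*n^6 + 750*n^5 + 1800*n^4 + 1220*n^3 - 2840*n^2 - 5880*n - 3312) * x^6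
    + (- 15*n^8 - 160*n^7 - 480*n^6 + 460*n^5 + 5455*n^4 + 11400*n^3 + 10820*n^2 + 5928*n + 1872) * x^5
    + (- 15*n^9 - 215*n^8 - 1150*n^7 - 2580*n^6 - 695*n^5 + 6835*n^4 + 11400*n^3 + 11020*n^2 +
        11592*n + 6480) * x^4
    + (25*n^10 + 255*n^9 + 655*n^8 - 1310*n^7 - 8615*n^6 - 11535*n^5 - 365*n^4 + 5030*n^3 -
        1900*n^2 - 1440*n + 1296) * x^3
    + (15*n^11 + 235*n^10 + 1355*n^9 + 3085*n^8 - 505*n^7 - 14325*n^6 - 21245*n^5 - 5775*n^4 +
        8860*n^3 + 5500*n^2 - 1104*n - 1440) * x^2
    + (- 30*n^12 - 345*n^11 - 1210*n^10 + 135*n^9 + 9800*n^8 + 19245*n^7 + 3410*n^6 - 24255*n^5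
        - 20730*n^4 + 1860*n^3 + 8280*n^2 + 2880*n) * x
    + (10*n^13 + 100*n^12 + 220*n^11 - 820*n^10 - 4100*n^9 - 2900*n^8 + 11940*n^7 + 23940*n^6 +
        7890*n^5 - 16000*n^4 - 15960*n^3 - 4320*n^2)"

text \<open>
  The term ratio of \<open>base_term\<close>; it determines the two polynomials multiplying \<open>f\<close> in the
  telescoping sum.
\<close>

lemma base_term_Suc:
  "base_term m (Suc l) * ((real l + 1) * (real l + 3) * (real l + 4))
     = base_term m l * ((real m + 2 + real l) * (real m + 3 - real l) ^ 2)"
proof -
  have "fact (m + 1 + Suc l) = (real m + 2 + real l) * (fact (m + 1 + l) :: real)"
    by (simp add: algebra_simps)
  moreover have "rfact (int l) = (real l + 1) * rfact (int (Suc l))"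
      "rfact (int l + 2) = (real l + 3) * rfact (int (Suc l) + 2)"
      "rfact (int l + 3) = (real l + 4) * rfact (int (Suc l) + 3)"
      "rfact (int m + 3 - int (Suc l)) = (real m + 3 - real l) * rfact (int m + 3 - int l)"
    using rfact_step[of "int l + 1"] rfact_step[of "int l + 3"] rfact_step[of "int l + 4"]
      rfact_step[of "int m + 3 - int l"]
    by (simp_all add: algebra_simps)
  ultimately show ?thesis
    unfolding base_term_def power_mult_distrib by (simp only: mult_ac power2_eq_square)
qed

text \<open>
  The antidifference is \<open>l (l + 2) (l + 3) f l\<close> times \<open>base_term m l\<close>. At \<open>l = 0\<close> it vanishes because of
  the polynomial factor, at \<open>l = m + 4\<close> because \<open>base_term\<close> contains the reciprocal factorial of \<open>-1\<close>.
\<close>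

lemma sum_base_term_telescope:
  "(\<Sum>l\<le>m + 3. base_term m l * ((real m + 2 + real l) * (real m + 3 - real l) ^ 2 * f (real l + 1)
       - real l * (real l + 2) * (real l + 3) * f (real l))) = 0"
proof -
  define G where "G l = base_term m l * (real l * (real l + 2) * (real l + 3)) * f (real l)" for l
  have "(\<Sum>l\<le>m + 3. base_term m l * ((real m + 2 + real l) * (real m + 3 - real l) ^ 2 * f (real l + 1)
       - real l * (real l + 2) * (real l + 3) * f (real l))) = (\<Sum>l\<le>m + 3. G (Suc l) - G l)"
  proof (rule sum.cong[OF refl])
    fix l
    have "G (Suc l) = base_term m l * ((real m + 2 + real l) * (real m + 3 - real l) ^ 2) * f (real l + 1)"
      unfolding base_term_Suc[symmetric] G_def by (simp add: algebra_simps)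
    then show "base_term m l * ((real m + 2 + real l) * (real m + 3 - real l) ^ 2 * f (real l + 1)
       - real l * (real l + 2) * (real l + 3) * f (real l)) = G (Suc l) - G l"
      unfolding G_def by (simp only: algebra_simps)
  qed
  also have "\<dots> = G (Suc (m + 3)) - G 0"
    unfolding lessThan_Suc_atMost[symmetric] by (rule sum_lessThan_telescope)
  also have "\<dots> = 0"
    by (simp add: G_def base_term_def rfact_def)
  finally show ?thesis .
qed

text \<open>
  The first ten cofactors belong to the terms of \<open>CT_alt\<close>, the other two to \<open>a\<^sub>n\<^sub>+\<^sub>1\<close> and \<open>a\<^sub>n\<close>.
\<close>

lemma cofactor_identity:
  fixes n x :: real
  shows "5 * (n - 1) * n^2 * (n + 2)^2 * (n + 3)^2 * (n + 4) * (
      cofactor 2 0 0 0 4 2 3 1 n x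
    - cofactor 1 0 0 0 5 3 2 0 n x
    + cofactor 0 0 0 0 5 3 2 1 n x
    - cofactor 0 0 0 0 4 2 3 3 n x
    + cofactor 0 0 1 0 2 2 3 3 n x
    - cofactor 0 0 2 0 1 2 3 2 n x
    + cofactor 0 0 2 1 0 2 3 1 n x
    - cofactor 0 0 1 2 0 2 3 1 n x
    + cofactor 0 1 0 2 1 2 3 0 n x
    - cofactor 1 1 0 1 2 2 3 0 n x)
    - 24 * ((5 * n^3 - 5 * n + 6) * cofactor 0 2 3 2 0 2 3 3 n x
      - (5 * n^2 + 15 * n + 18) * cofactor 0 1 2 1 1 2 3 3 n x)
   = (n + x) * (n + 1 - x)^2 * (n^2 * (n - 1) * certificate n (x + 1))
      - x * (x + 2) * (x + 3) * (n^2 * (n - 1) * certificate n x)"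
proof -
  have poch: "pochhammer y 0 = 1" "pochhammer y (Suc 0) = y" "pochhammer y 2 = y * (y + 1)"
      "pochhammer y 3 = y * (y + 1) * (y + 2)" "pochhammer y 4 = y * (y + 1) * (y + 2) * (y + 3)"
      "pochhammer y 5 = y * (y + 1) * (y + 2) * (y + 3) * (y + 4)"
      "pochhammer y 6 = y * (y + 1) * (y + 2) * (y + 3) * (y + 4) * (y + 5)" for y :: real
    by (simp_all add: eval_nat_numeral pochhammer_Suc del: power_Suc)
  show ?thesis
    unfolding certificate_def by (simp add: cofactor_def poch) algebra
qed

text \<open>
  All five exponents are equal, so this is the constant term of the \<open>n\<close>-th power of
  \<open>(1 + u) (1 + v) (1 + u + v) / (u v)\<close>.
\<close>

lemma a_seq_eq_CT: "real (a_seq n) = CT n (int n) (int n) n n"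
proof -
  have "real ((n choose j)\<^sup>2 * ((n + j) choose j))
      = ibinom n (int j) * ibinom (n + j) (int n) * ibinom n (int j)" for j
    using binomial_symmetric[of j "n + j"] by (simp add: ibinom_of_nat power2_eq_square)
  then show ?thesis by (simp add: a_seq_def CT_def atLeast0AtMost)
qed

lemma CT_alt_eq_a_seq:
  fixes m :: nat
  defines "n \<equiv> real m + 2"
  shows "5 * (n - 1) * n^2 * (n + 2)^2 * (n + 3)^2 * (n + 4)
      * CT_alt (m + 1) (int m + 1) (int m - 1) m (m + 1)
    = 24 * ((5 * n^3 - 5 * n + 6) * real (a_seq (m + 3)) - (5 * n^2 + 15 * n + 18) * real (a_seq (m + 2)))"
proof -
  let ?n = "real m + 2"
  let ?S = "\<lambda>q. \<Sum>l\<le>m + 3. base_term m l * q l"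
  note [simp] = doubleton_eq_iff
  have t0: "CT (m + 1 + 2) (int m + 1 + 1) (int m - 1) m (m + 1)
      = ?S (\<lambda>l. cofactor 2 0 0 0 4 2 3 1 ?n (real l))"
    by (rule CT_eq_sum_base_term) simp_all
  have t1: "CT (m + 1 + 1) (int m + 1 + 2) (int m - 1) m (m + 1)
      = ?S (\<lambda>l. cofactor 1 0 0 0 5 3 2 0 ?n (real l))"
    by (rule CT_eq_sum_base_term) simp_all
  have t2: "CT (m + 1) (int m + 1 + 2) (int m - 1 + 1) m (m + 1)
      = ?S (\<lambda>l. cofactor 0 0 0 0 5 3 2 1 ?n (real l))"
    by (rule CT_eq_sum_base_term) simp_all
  have t3: "CT (m + 1) (int m + 1 + 1) (int m - 1 + 2) m (m + 1)
      = ?S (\<lambda>l. cofactor 0 0 0 0 4 2 3 3 ?n (real l))"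
    by (rule CT_eq_sum_base_term) simp_all
  have t4: "CT (m + 1) (int m + 1) (int m - 1 + 2) (m + 1) (m + 1)
      = ?S (\<lambda>l. cofactor 0 0 1 0 2 2 3 3 ?n (real l))"
    by (rule CT_eq_sum_base_term) simp_all
  have t5: "CT (m + 1) (int m + 1) (int m - 1 + 1) (m + 2) (m + 1)
      = ?S (\<lambda>l. cofactor 0 0 2 0 1 2 3 2 ?n (real l))"
    by (rule CT_eq_sum_base_term) simp_all
  have t6: "CT (m + 1) (int m + 1) (int m - 1) (m + 2) (m + 1 + 1)
      = ?S (\<lambda>l. cofactor 0 0 2 1 0 2 3 1 ?n (real l))"
    by (rule CT_eq_sum_base_term) simp_all
  have t7: "CT (m + 1) (int m + 1) (int m - 1) (m + 1) (m + 1 + 2)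
      = ?S (\<lambda>l. cofactor 0 0 1 2 0 2 3 1 ?n (real l))"
    by (rule CT_eq_sum_base_term) simp_all
  have t8: "CT (m + 1 + 1) (int m + 1) (int m - 1) m (m + 1 + 2)
      = ?S (\<lambda>l. cofactor 0 1 0 2 1 2 3 0 ?n (real l))"
    by (rule CT_eq_sum_base_term) simp_all
  have t9: "CT (m + 1 + 2) (int m + 1) (int m - 1) m (m + 1 + 1)
      = ?S (\<lambda>l. cofactor 1 1 0 1 2 2 3 0 ?n (real l))"
    by (rule CT_eq_sum_base_term) simp_all
  have t10: "real (a_seq (m + 2))
      = ?S (\<lambda>l. cofactor 0 1 2 1 1 2 3 3 ?n (real l))"
    unfolding a_seq_eq_CT by (rule CT_eq_sum_base_term) simp_all
  have t11: "real (a_seq (m + 3))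
      = ?S (\<lambda>l. cofactor 0 2 3 2 0 2 3 3 ?n (real l))"
    unfolding a_seq_eq_CT by (rule CT_eq_sum_base_term) simp_all
  \<comment> \<open>The polynomials in \<open>n\<close> are hidden behind names to keep them unexpanded while the sums are merged.\<close>
  define c where "c = 5 * (n - 1) * n^2 * (n + 2)^2 * (n + 3)^2 * (n + 4)"
  define c0 where "c0 = 5 * n^2 + 15 * n + 18"
  define c1 where "c1 = 5 * n^3 - 5 * n + 6"
  define f where "f x = n^2 * (n - 1) * certificate n x" for x
  have "c * CT_alt (m + 1) (int m + 1) (int m - 1) m (m + 1)
      - 24 * (c1 * real (a_seq (m + 3)) - c0 * real (a_seq (m + 2)))
    = ?S (\<lambda>l. c * (cofactor 2 0 0 0 4 2 3 1 ?n (real l)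
        - cofactor 1 0 0 0 5 3 2 0 ?n (real l)
        + cofactor 0 0 0 0 5 3 2 1 ?n (real l)
        - cofactor 0 0 0 0 4 2 3 3 ?n (real l)
        + cofactor 0 0 1 0 2 2 3 3 ?n (real l)
        - cofactor 0 0 2 0 1 2 3 2 ?n (real l)
        + cofactor 0 0 2 1 0 2 3 1 ?n (real l)
        - cofactor 0 0 1 2 0 2 3 1 ?n (real l)
        + cofactor 0 1 0 2 1 2 3 0 ?n (real l)
        - cofactor 1 1 0 1 2 2 3 0 ?n (real l))
      - 24 * (c1 * cofactor 0 2 3 2 0 2 3 3 ?n (real l)
        - c0 * cofactor 0 1 2 1 1 2 3 3 ?n (real l)))"
    unfolding CT_alt_def t0 t1 t2 t3 t4 t5 t6 t7 t8 t9 t10 t11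
    by (simp add: sum.distrib sum_subtractf sum_distrib_left algebra_simps)
  also have "\<dots> = ?S (\<lambda>l. (?n + real l) * (real m + 3 - real l)^2 * f (real l + 1)
      - real l * (real l + 2) * (real l + 3) * f (real l))"
    unfolding c_def c0_def c1_def f_def n_def cofactor_identity by (simp add: algebra_simps)
  also have "\<dots> = 0"
    by (rule sum_base_term_telescope)
  finally show ?thesis by (simp add: c_def c0_def c1_def)
qed

theorem proposition15:
  fixes n :: nat
  assumes "n \<ge> 2"
  shows "real (SB n) =
    24 / 5 * (((5 * real n ^ 3 - 5 * real n + 6) * real (a_seq (n + 1))
                - (5 * real n ^ 2 + 15 * real n + 18) * real (a_seq n))
              / ((real n - 1) * real n ^ 2 * (real n + 2) ^ 2 * (real n + 3) ^ 2 * (real n + 4)))"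
proof -
  define m where "m = n - 2"
  have m: "m + 2 = n" "m + 3 = n + 1" "real m + 2 = real n"
    using assms by (simp_all add: m_def)
  let ?D = "(real n - 1) * real n ^ 2 * (real n + 2) ^ 2 * (real n + 3) ^ 2 * (real n + 4)"
  have "5 * ?D * real (SB n) = 24 * ((5 * real n ^ 3 - 5 * real n + 6) * real (a_seq (n + 1))
                - (5 * real n ^ 2 + 15 * real n + 18) * real (a_seq n))"
    using CT_alt_eq_a_seq[of m, folded SB_eq_CT_alt, unfolded m] by (simp only: mult.assoc)
  moreover have "?D \<noteq> 0" using assms by auto
  moreover have "s = 24 / 5 * (N / D)" if "5 * D * s = 24 * N" "D \<noteq> 0" for s N D :: real
    using that by (simp add: field_simps)
  ultimately show ?thesis by blast
qed

end
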